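(* Let $H=(X,(s_i)_{i\in I})$ be a hypergraph with correspondence $\tau:X\to I$, and let $f:X\to\{0,1,2\}$ be such that $\tau(x)\ne\tau(y)$ for all distinct $x,y\in f^{-1}(1)$. Then there exists a minimal Roman hitting function $g$ with $f\le g$ if and only if there exist a set $R_2$ with $f^{-1}(2)\subseteq R_2\subseteq f^{-1}(1)\cup f^{-1}(2)$ and a map $\rho:R_2\to I$ such that: (1) for all $x\in R_2$, $\rho(x)\ne\tau(x)$; (2) for all $x\in R_2$, $s_{\rho(x)}\cap R_2=\{x\}$; (3) for all $x\in f^{-1}(1)\setminus R_2$, $s_{\tau(x)}\cap R_2=\emptyset$; (4) for every $i\in I$ with $\tau^{-1}(i)=\emptyset$: if $s_i\subseteq\big(\bigcup_{x\in f^{-1}(1)\setminus R_2}s_{\tau(x)}\big)\cup\big(\bigcup_{x\in R_2}s_{\rho(x)}\big)$, then $s_i\cap R_2\ne\emptyset$.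
   Context: A hypergraph is $H=(X,(s_i)_{i\in I})$ with finite $X$, finite index set $I$, $s_i\subseteq X$ (repetitions allowed). A correspondence is a map $\tau:X\to I$ with $x\in s_{\tau(x)}$ for all $x$. A function $g:X\to\{0,1,2\}$ is a Roman hitting function (rhf) if for every $i\in I$ there is $x\in s_i$ with $g(x)=2$ or there is $x$ with $\tau(x)=i$ and $g(x)=1$. Functions are ordered pointwise; an rhf $g$ is minimal if every rhf $h\le g$ equals $g$. *)

theory Defs
  imports Main "HOL-Library.FuncSet"
begin

text \<open>
  Maps with domain \<open>X\<close> are HOL functions whose values outside \<open>X\<close> are irrelevant; hence the
  order and the equality of such maps are taken on \<open>X\<close> only.
\<close>

definition hypergraph :: "'a set \<Rightarrow> 'i set \<Rightarrow> ('i \<Rightarrow> 'a set) \<Rightarrow> bool" where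
  "hypergraph X I s \<longleftrightarrow> finite X \<and> finite I \<and> (\<forall>i\<in>I. s i \<subseteq> X)"

definition correspondence ::
    "'a set \<Rightarrow> 'i set \<Rightarrow> ('i \<Rightarrow> 'a set) \<Rightarrow> ('a \<Rightarrow> 'i) \<Rightarrow> bool" where
  "correspondence X I s \<tau> \<longleftrightarrow> \<tau> \<in> X \<rightarrow> I \<and> (\<forall>x\<in>X. x \<in> s (\<tau> x))"

definition fun_le_on :: "'a set \<Rightarrow> ('a \<Rightarrow> nat) \<Rightarrow> ('a \<Rightarrow> nat) \<Rightarrow> bool" where
  "fun_le_on X f g \<longleftrightarrow> (\<forall>x\<in>X. f x \<le> g x)"

definition roman_hitting ::
    "'a set \<Rightarrow> 'i set \<Rightarrow> ('i \<Rightarrow> 'a set) \<Rightarrow> ('a \<Rightarrow> 'i) \<Rightarrow> ('a \<Rightarrow> nat) \<Rightarrow> bool" where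
  "roman_hitting X I s \<tau> g \<longleftrightarrow>
     g \<in> X \<rightarrow> {0, 1, 2} \<and>
     (\<forall>i\<in>I. (\<exists>x\<in>s i. g x = 2) \<or> (\<exists>x\<in>X. \<tau> x = i \<and> g x = 1))"

definition minimal_roman_hitting ::
    "'a set \<Rightarrow> 'i set \<Rightarrow> ('i \<Rightarrow> 'a set) \<Rightarrow> ('a \<Rightarrow> 'i) \<Rightarrow> ('a \<Rightarrow> nat) \<Rightarrow> bool" where
  "minimal_roman_hitting X I s \<tau> g \<longleftrightarrow>
     roman_hitting X I s \<tau> g \<and>
     (\<forall>h. roman_hitting X I s \<tau> h \<and> fun_le_on X h g \<longrightarrow> (\<forall>x\<in>X. h x = g x))"

definition preimage_on :: "'a set \<Rightarrow> ('a \<Rightarrow> 'b) \<Rightarrow> 'b \<Rightarrow> 'a set" where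
  "preimage_on X f v = {x \<in> X. f x = v}"

end

theory Submission imports Defs begin

text \<open>
  If \<open>g \<ge> f\<close> is minimal, take \<open>R\<^sub>2 = {x. g x = 2 \<and> f x \<noteq> 0}\<close>; minimality gives every vertex of
  value 2 a private edge other than its own, which serves as \<open>\<rho> x\<close>.
  Conversely, let \<open>U\<close> be the union of edges in condition (4), put \<open>g = 2\<close> on
  \<open>R\<^sub>2 \<union> (X - U)\<close>, \<open>g = 1\<close> on \<open>f\<^sup>-\<^sup>1(1) - R\<^sub>2\<close> and on one \<open>\<tau>\<close>-preimage of every edge not yet hit, and let
  \<open>h \<le> g\<close> be minimal. The edges making up \<open>U\<close> can only be hit by the values of \<open>f\<close> on the vertices
  they come from, so \<open>f \<le> h\<close>.
\<close>

text \<open>Among the Roman hitting functions below \<open>g\<close>, one with the least sum of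
  values over the finite set \<open>X\<close> is minimal: going strictly below it at a single vertex
  would lower the sum.\<close>

lemma minimal_roman_hitting_below:
  assumes "finite X" and "roman_hitting X I s \<tau> g"
  obtains h where "minimal_roman_hitting X I s \<tau> h" and "fun_le_on X h g"
proof -
  let ?P = "\<lambda>h. roman_hitting X I s \<tau> h \<and> fun_le_on X h g"
  have "?P g"
    using assms by (simp add: fun_le_on_def)
  then obtain h where h: "?P h" and least: "\<And>k. ?P k \<Longrightarrow> sum h X \<le> sum k X"
    using ex_has_least_nat[of ?P g "\<lambda>h. sum h X"] by blast
  have "k x = h x" if k: "roman_hitting X I s \<tau> k" "fun_le_on X k h" and x: "x \<in> X" for k x
  proof (rule ccontr)
    assume "k x \<noteq> h x"
    with k x have "k x < h x"
      by (auto simp: fun_le_on_def le_less)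
    with k x have "sum k X < sum h X"
      by (intro sum_strict_mono_ex1) (auto simp: \<open>finite X\<close> fun_le_on_def)
    moreover have "?P k"
      using k h by (force simp: fun_le_on_def intro: order_trans)
    ultimately show False
      using least[of k] by simp
  qed
  then have "minimal_roman_hitting X I s \<tau> h"
    using h by (simp add: minimal_roman_hitting_def)
  then show ?thesis
    using h that by simp
qed

text \<open>A value 1 at \<open>x\<close> serves only the edge \<open>\<tau> x\<close>. If a vertex
  of value 2 hits that edge as well, \<open>x\<close> can be lowered to 0, against
  minimality.\<close>

lemma minimal_roman_hitting_one:
  assumes g: "minimal_roman_hitting X I s \<tau> g" and x: "x \<in> X" "g x = 1" and y: "y \<in> s (\<tau> x)"
  shows "g y \<noteq> 2"
proof
  assume y2: "g y = 2"
  let ?h = "g(x := 0)"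
  have "roman_hitting X I s \<tau> g"
    using g by (simp add: minimal_roman_hitting_def)
  then have range: "g \<in> X \<rightarrow> {0, 1, 2}"
    and hit: "\<And>i. i \<in> I \<Longrightarrow> (\<exists>z\<in>s i. g z = 2) \<or> (\<exists>z\<in>X. \<tau> z = i \<and> g z = 1)"
    by (simp_all add: roman_hitting_def)
  have two: "?h z = 2" if "g z = 2" for z
    using that x by auto
  have "(\<exists>z\<in>s i. ?h z = 2) \<or> (\<exists>z\<in>X. \<tau> z = i \<and> ?h z = 1)" if "i \<in> I" for i
  proof (cases "i = \<tau> x")
    case True
    then show ?thesis
      using y two[OF y2] by blast
  next
    case False
    then have "?h z = g z" if "\<tau> z = i" for z
      using that by auto
    then show ?thesis
      using hit[OF that] two by metis
  qed
  then have "roman_hitting X I s \<tau> ?h"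
    using range by (auto simp: roman_hitting_def Pi_iff)
  moreover have "fun_le_on X ?h g"
    by (simp add: fun_le_on_def)
  ultimately have "?h x = g x"
    using g x unfolding minimal_roman_hitting_def by blast
  then show False
    using x by simp
qed

text \<open>Lowering \<open>x\<close> from 2 to 1 must leave some edge \<open>i\<close> unhit. The
  new value 1 still serves \<open>\<tau> x\<close>, so \<open>i\<close> is another edge. All old
  values 1 survive, so \<open>g\<close> hits \<open>i\<close> by a value 2, and the only value 2
  that was lost is the one at \<open>x\<close>.\<close>

lemma minimal_roman_hitting_two:
  assumes g: "minimal_roman_hitting X I s \<tau> g" and x: "x \<in> X" "g x = 2"
  shows "\<exists>i\<in>I. i \<noteq> \<tau> x \<and> x \<in> s i \<and> (\<forall>y\<in>s i. g y = 2 \<longrightarrow> y = x)"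
proof -
  let ?h = "g(x := 1)"
  have rh: "roman_hitting X I s \<tau> g"
    using g by (simp add: minimal_roman_hitting_def)
  have "fun_le_on X ?h g" "?h x \<noteq> g x"
    using x by (simp_all add: fun_le_on_def)
  then have "\<not> roman_hitting X I s \<tau> ?h"
    using g x unfolding minimal_roman_hitting_def by blast
  moreover have "?h \<in> X \<rightarrow> {0, 1, 2}"
    using rh by (auto simp: roman_hitting_def Pi_iff)
  ultimately obtain i where i: "i \<in> I" "\<And>y. y \<in> s i \<Longrightarrow> ?h y \<noteq> 2"
    and one: "\<And>y. y \<in> X \<Longrightarrow> \<tau> y = i \<Longrightarrow> ?h y \<noteq> 1"
    unfolding roman_hitting_def by blast
  have "i \<noteq> \<tau> x"
    using one[of x] x by auto
  have only: "y = x" if "y \<in> s i" "g y = 2" for y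
    using i(2)[of y] that by (auto split: if_splits)
  have "g y \<noteq> 1" if "y \<in> X" "\<tau> y = i" for y
    using one[OF that] by (auto split: if_splits)
  then obtain y where "y \<in> s i" "g y = 2"
    using rh i(1) unfolding roman_hitting_def by blast
  then show ?thesis
    using i(1) \<open>i \<noteq> \<tau> x\<close> only by blast
qed

theorem theorem9:
  fixes X :: "'a set" and I :: "'i set" and s :: "'i \<Rightarrow> 'a set"
    and \<tau> :: "'a \<Rightarrow> 'i" and f :: "'a \<Rightarrow> nat"
  assumes "hypergraph X I s"
    and "correspondence X I s \<tau>"
    and "f \<in> X \<rightarrow> {0, 1, 2}"
    and "\<forall>x\<in>preimage_on X f 1. \<forall>y\<in>preimage_on X f 1. x \<noteq> y \<longrightarrow> \<tau> x \<noteq> \<tau> y"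
  shows "(\<exists>g. minimal_roman_hitting X I s \<tau> g \<and> fun_le_on X f g) \<longleftrightarrow>
    (\<exists>R\<^sub>2 \<rho>.
       preimage_on X f 2 \<subseteq> R\<^sub>2 \<and> R\<^sub>2 \<subseteq> preimage_on X f 1 \<union> preimage_on X f 2 \<and>
       \<rho> \<in> R\<^sub>2 \<rightarrow> I \<and>
       (\<forall>x\<in>R\<^sub>2. \<rho> x \<noteq> \<tau> x) \<and>
       (\<forall>x\<in>R\<^sub>2. s (\<rho> x) \<inter> R\<^sub>2 = {x}) \<and>
       (\<forall>x\<in>preimage_on X f 1 - R\<^sub>2. s (\<tau> x) \<inter> R\<^sub>2 = {}) \<and>
       (\<forall>i\<in>I. preimage_on X \<tau> i = {} \<longrightarrow>
          s i \<subseteq> (\<Union>x\<in>preimage_on X f 1 - R\<^sub>2. s (\<tau> x)) \<union> (\<Union>x\<in>R\<^sub>2. s (\<rho> x)) \<longrightarrow>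
          s i \<inter> R\<^sub>2 \<noteq> {}))"
  (is "?L \<longleftrightarrow> ?R")
proof
  assume ?L
  then obtain g where g: "minimal_roman_hitting X I s \<tau> g" and le: "fun_le_on X f g"
    by blast
  have rh: "roman_hitting X I s \<tau> g"
    using g by (simp add: minimal_roman_hitting_def)
  have g_range: "g x \<in> {0, 1, 2}" if "x \<in> X" for x
    using rh that by (auto simp: roman_hitting_def Pi_iff)
  have f_le: "f x \<le> g x" if "x \<in> X" for x
    using le that by (auto simp: fun_le_on_def)
  \<comment> \<open>The restriction to \<open>f x \<noteq> 0\<close> is forced by the upper bound on
    \<open>R\<^sub>2\<close>; vertices that \<open>g\<close> raises from 0 to 2 stay
    outside.\<close>
  define R where "R = {x \<in> X. g x = 2 \<and> f x \<noteq> 0}"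
  have "\<forall>x\<in>R. \<exists>i. i \<in> I \<and> i \<noteq> \<tau> x \<and> x \<in> s i \<and> (\<forall>y\<in>s i. g y = 2 \<longrightarrow> y = x)"
    using minimal_roman_hitting_two[OF g] unfolding R_def by blast
  then obtain \<rho> where \<rho>: "\<And>x. x \<in> R \<Longrightarrow> \<rho> x \<in> I" "\<And>x. x \<in> R \<Longrightarrow> \<rho> x \<noteq> \<tau> x"
    "\<And>x. x \<in> R \<Longrightarrow> x \<in> s (\<rho> x)" "\<And>x y. x \<in> R \<Longrightarrow> y \<in> s (\<rho> x) \<Longrightarrow> g y = 2 \<Longrightarrow> y = x"
    by metis
  have one: "x \<in> X \<and> g x = 1" if "x \<in> preimage_on X f 1 - R" for x
    using that f_le[of x] g_range[of x] by (auto simp: R_def preimage_on_def)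
  have no_two: "g y \<noteq> 2" if "x \<in> preimage_on X f 1 - R" "y \<in> s (\<tau> x)" for x y
    using minimal_roman_hitting_one[OF g] one that by blast
  have "preimage_on X f 2 \<subseteq> R"
    using f_le g_range by (fastforce simp: R_def preimage_on_def)
  moreover have "R \<subseteq> preimage_on X f 1 \<union> preimage_on X f 2"
    using assms(3) by (auto simp: R_def preimage_on_def Pi_iff)
  moreover have "\<forall>x\<in>R. s (\<rho> x) \<inter> R = {x}"
    using \<rho> by (auto simp: R_def)
  moreover have "s (\<tau> x) \<inter> R = {}" if "x \<in> preimage_on X f 1 - R" for x
    using no_two[OF that] by (auto simp: R_def)
  moreover have "s i \<inter> R \<noteq> {}"
    if i: "i \<in> I" "preimage_on X \<tau> i = {}"
      and sub: "s i \<subseteq> (\<Union>x\<in>preimage_on X f 1 - R. s (\<tau> x)) \<union> (\<Union>x\<in>R. s (\<rho> x))" for i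
  proof -
    \<comment> \<open>An edge without a \<open>\<tau>\<close>-preimage can only be hit by a value 2.
      Such a vertex avoids every \<open>s (\<tau> x)\<close> of the first union, so it lies in some
      private edge \<open>s (\<rho> x)\<close> and equals \<open>x\<close>.\<close>
    obtain y where y: "y \<in> s i" "g y = 2"
      using rh i by (auto simp: roman_hitting_def preimage_on_def)
    then obtain x where "x \<in> R" "y \<in> s (\<rho> x)"
      using sub no_two by blast
    then show ?thesis
      using \<rho>(4) y by blast
  qed
  ultimately show ?R
    using \<rho>(1,2) by (intro exI[of _ R] exI[of _ \<rho>]) simp
next
  assume ?R
  then obtain R \<rho> where R2: "preimage_on X f 2 \<subseteq> R"
    and R12: "R \<subseteq> preimage_on X f 1 \<union> preimage_on X f 2"
    and \<rho>I: "\<rho> \<in> R \<rightarrow> I"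
    and c1[rule_format]: "\<forall>x\<in>R. \<rho> x \<noteq> \<tau> x"
    and c2[rule_format]: "\<forall>x\<in>R. s (\<rho> x) \<inter> R = {x}"
    and c3[rule_format]: "\<forall>x\<in>preimage_on X f 1 - R. s (\<tau> x) \<inter> R = {}"
    and c4[rule_format]: "\<forall>i\<in>I. preimage_on X \<tau> i = {} \<longrightarrow>
          s i \<subseteq> (\<Union>x\<in>preimage_on X f 1 - R. s (\<tau> x)) \<union> (\<Union>x\<in>R. s (\<rho> x)) \<longrightarrow>
          s i \<inter> R \<noteq> {}"
    by (elim exE conjE) (rule that)
  have sX: "\<And>i. i \<in> I \<Longrightarrow> s i \<subseteq> X" and "finite X"
    using assms(1) by (auto simp: hypergraph_def)
  have \<tau>I: "\<And>x. x \<in> X \<Longrightarrow> \<tau> x \<in> I" and \<tau>s: "\<And>x. x \<in> X \<Longrightarrow> x \<in> s (\<tau> x)"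
    using assms(2) by (auto simp: correspondence_def)
  define A where "A = preimage_on X f 1 - R"
  define U where "U = (\<Union>x\<in>A. s (\<tau> x)) \<union> (\<Union>x\<in>R. s (\<rho> x))"
  \<comment> \<open>The edges that neither the values 2 on \<open>R \<union> (X - U)\<close> nor the
    values 1 on \<open>A\<close> hit. Condition (4) gives each of them a
    \<open>\<tau>\<close>-preimage, so \<open>p\<close> can choose one.\<close>
  define J where "J = {i \<in> I. s i \<subseteq> U \<and> s i \<inter> R = {} \<and> i \<notin> \<tau> ` A}"
  define p where "p i = (SOME x. x \<in> X \<and> \<tau> x = i)" for i
  have AX: "A \<subseteq> X" and RX: "R \<subseteq> X"
    using R12 by (auto simp: A_def preimage_on_def)
  have p: "p i \<in> X \<and> \<tau> (p i) = i" if "i \<in> J" for i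
  proof -
    have "preimage_on X \<tau> i \<noteq> {}"
      using c4[of i] that by (auto simp: J_def U_def A_def)
    then have "\<exists>x. x \<in> X \<and> \<tau> x = i"
      by (auto simp: preimage_on_def)
    then show ?thesis
      unfolding p_def by (rule someI_ex)
  qed
  define g :: "'a \<Rightarrow> nat" where
    "g x = (if x \<in> R \<union> (X - U) then 2 else if x \<in> A \<union> p ` J then 1 else 0)" for x
  have AU: "A \<subseteq> U"
    using AX \<tau>s by (auto simp: U_def)
  have g2: "g x = 2 \<longleftrightarrow> x \<in> R \<union> (X - U)" for x
    by (simp add: g_def)
  have gA: "g x = 1" if "x \<in> A" for x
    using that AU by (auto simp: g_def A_def)
  have gp: "g (p i) = 1" if "i \<in> J" for i
  proof -
    have "p i \<in> s i"
      using p[OF that] \<tau>s by metis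
    then show ?thesis
      using that by (auto simp: g_def J_def)
  qed
  have pos: "x \<in> R \<or> x \<in> A \<or> x \<in> p ` J" if "g x \<noteq> 0" "x \<in> U" for x
    using that by (auto simp: g_def split: if_splits)
  have "(\<exists>x\<in>s i. g x = 2) \<or> (\<exists>x\<in>X. \<tau> x = i \<and> g x = 1)" if i: "i \<in> I" for i
  proof (cases "i \<in> J")
    case True
    then show ?thesis
      using p gp by blast
  next
    case False
    then consider "\<not> s i \<subseteq> U" | "s i \<inter> R \<noteq> {}" | "i \<in> \<tau> ` A"
      using i by (auto simp: J_def)
    then show ?thesis
      using sX[OF i] gA AX by cases (auto simp: g2)
  qed
  moreover have "g \<in> X \<rightarrow> {0, 1, 2}"
    by (simp add: g_def)
  ultimately have "roman_hitting X I s \<tau> g"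
    by (simp add: roman_hitting_def)
  then obtain h where h: "minimal_roman_hitting X I s \<tau> h" and le: "fun_le_on X h g"
    using minimal_roman_hitting_below \<open>finite X\<close> by blast
  have h_rh: "roman_hitting X I s \<tau> h"
    using h by (simp add: minimal_roman_hitting_def)
  have h_pos: "y \<in> R \<or> y \<in> A \<or> y \<in> p ` J" if "y \<in> X" "y \<in> U" "h y \<noteq> 0" for y
  proof -
    have "g y \<noteq> 0"
      using le that by (force simp: fun_le_on_def)
    then show ?thesis
      using pos that by blast
  qed
  have h_two: "y \<in> R" if "y \<in> X" "y \<in> U" "h y = 2" for y
  proof -
    have "g y \<ge> 2"
      using le that by (force simp: fun_le_on_def)
    then have "g y = 2"
      by (auto simp: g_def split: if_splits)
    then show ?thesis
      using that g2 by blast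
  qed
  have hA: "h x = 1" if x: "x \<in> A" for x
  proof -
    have sU: "s (\<tau> x) \<subseteq> U" and sR: "s (\<tau> x) \<inter> R = {}" and iI: "\<tau> x \<in> I"
      using x c3 \<tau>I AX by (auto simp: U_def A_def)
    \<comment> \<open>The edge \<open>\<tau> x\<close> lies in \<open>U\<close> and avoids
      \<open>R\<close>, so only a value 1 can hit it.\<close>
    have "\<not> (\<exists>y\<in>s (\<tau> x). h y = 2)"
      using h_two sU sR sX[OF iI] by blast
    then obtain y where y: "y \<in> X" "\<tau> y = \<tau> x" "h y = 1"
      using h_rh iI unfolding roman_hitting_def by blast
    then have ys: "y \<in> s (\<tau> x)"
      using \<tau>s by metis
    then have "y \<in> A \<or> y \<in> p ` J"
      using h_pos[of y] y sU sR by auto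
    moreover have "y \<notin> p ` J"
      using p y(2) x by (auto simp: J_def)
    ultimately have "y = x"
      using assms(4) x y(2) by (auto simp: A_def)
    then show ?thesis
      using y by simp
  qed
  have hR: "h x = 2" if x: "x \<in> R" for x
  proof -
    have sU: "s (\<rho> x) \<subseteq> U" and iI: "\<rho> x \<in> I"
      using x \<rho>I by (auto simp: U_def)
    have "\<not> (\<exists>y\<in>X. \<tau> y = \<rho> x \<and> h y = 1)"
    proof
      assume "\<exists>y\<in>X. \<tau> y = \<rho> x \<and> h y = 1"
      then obtain y where y: "y \<in> X" "\<tau> y = \<rho> x" "h y = 1"
        by blast
      then have ys: "y \<in> s (\<rho> x)"
        using \<tau>s by metis
      then consider "y \<in> R" | "y \<in> A" | "y \<in> p ` J"
        using h_pos[of y] y sU by auto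
      then show False
      proof cases
        case 1
        then have "y = x"
          using c2[OF x] ys by blast
        then show False
          using c1[OF x] y(2) by simp
      next
        case 2
        then show False
          using c3[of y] c2[OF x] y(2) by (auto simp: A_def)
      next
        case 3
        then have "\<rho> x \<in> J"
          using p y(2) by auto
        then show False
          using c2[OF x] by (auto simp: J_def)
      qed
    qed
    then obtain y where y: "y \<in> s (\<rho> x)" "h y = 2"
      using h_rh iI unfolding roman_hitting_def by blast
    then have "y \<in> R"
      using h_two sU sX[OF iI] by blast
    then have "y = x"
      using c2[OF x] y(1) by blast
    then show ?thesis
      using y(2) by simp
  qed
  have "f x \<le> h x" if x: "x \<in> X" for x
  proof -
    have "f x = 0 \<or> f x = 1 \<or> f x = 2"
      using funcset_mem[OF assms(3) x] by simp
    moreover have "x \<in> A \<or> x \<in> R" if "f x = 1"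
      using x that by (simp add: A_def preimage_on_def)
    moreover have "x \<in> R" if "f x = 2"
      using x that R2 by (auto simp: preimage_on_def)
    ultimately show ?thesis
      using hA[of x] hR[of x] by auto
  qed
  then have "fun_le_on X f h"
    by (simp add: fun_le_on_def)
  then show ?L
    using h by blast
qed

end
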